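(* Let $\mathcal B=(e_n)_{n=1}^\infty$ be a basis of a real Banach space $\mathbb X$ and let $w$ be a weight. (a) If $\mathcal B$ is $C_{al}$-$w$-almost-greedy, then $\mathcal B$ is $C_q$-quasi-greedy and has the $C_a$-$w$-Property (A), with constants $C_q\le C_{al}$ and $C_a\le C_{al}$. (b) If $\mathcal B$ is $C_q$-quasi-greedy and has the $C_a$-$w$-Property (A), then $\mathcal B$ is $C_{al}$-$w$-almost-greedy with $C_{al}\le C_qC_a$.
   Context: Basis: a Schauder basis $\mathcal B=(e_n)_{n=1}^\infty$ of a real Banach space $\mathbb X$ with biorthogonal functionals $(e_n^* )_{n=1}^\infty$ such that $0<\inf_n\min\{\|e_n\|,\|e_n^*\|\}\le\sup_n\max\{\|e_n\|,\|e_n^*\|\}<\infty$. For $x\in\mathbb X$, $\mathrm{supp}(x)=\{i\in\mathbb N: e_i^*(x)\neq0\}$. $\mathbb N^{<\infty}$ is the family of finite subsets of $\mathbb N$. For finite $A$, $P_A(x)=\sum_{j\in A}e_j^*(x)e_j$. For signs $\varepsilon=(\varepsilon_n)$, $\varepsilon_n\in\{\pm1\}$, and finite $A$, $\mathbf 1_{\varepsilon A}=\sum_{n\in A}\varepsilon_ne_n$. A weight is a sequence $w=(w_i)_{i=1}^\infty\in(0,\infty)^{\mathbb N}$; $w(A)=\sum_{i\in A}w_i$. A greedy set of $x$ of cardinality $m\in\mathbb N$ is a set $A_m(x)\subset\mathrm{supp}(x)$ with $|A_m(x)|=m$ and $\min_{k\in A_m(x)}|e_k^*(x)|\ge\sup_{k\notin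 A_m(x)}|e_k^*(x)|$; the corresponding greedy approximand is $\mathcal G_m(x)=P_{A_m(x)}(x)$. Inequalities involving $\mathcal G_m(x)$, $A_m(x)$ are required for every choice of greedy set. $\mathcal B$ is $w$-almost-greedy if there is $C\ge1$ such that $\|x-\mathcal G_m(x)\|\le C\,\tilde\sigma^w_{w(A_m(x))}(x)$ for all $x\in\mathbb X$, $m\in\mathbb N$, where $\tilde\sigma^w_\delta(x)=\inf\{\|x-P_A(x)\|: A\in\mathbb N^{<\infty},\ w(A)\le\delta\}$; the least such $C$ is $C_{al}$ and $\mathcal B$ is then called $C_{al}$-$w$-almost-greedy. $\mathcal B$ is quasi-greedy if there is $C$ with $\|x-\mathcal G_m(x)\|\le C\|x\|$ for all $x\in\mathbb X$, $m\in\mathbb N$; the least such $C$ is $C_q$ and $\mathcal B$ is then called $C_q$-quasi-greedy. $\mathcal B$ has the $w$-Property (A) if there is $C\ge1$ such that $\|x+t\mathbf 1_{\varepsilon A}\|\le C\|x+t\mathbf 1_{\eta B}\|$ for all $x\in\mathbb X$, all $A,B\in\mathbb N^{<\infty}$ with $w(A)\le w(B)$, $A\cap B=\emptyset$, $\mathrm{supp}(x)\cap(A\cup B)=\emptyset$, all signs $\varepsilon,\eta$, and all $t\ge\sup_j|e_j^*(x)|$; the least such $C$ is $C_a$ and $\mathcal B$ is then said to have the $C_a$-$w$-Property (A). *)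

theory Defs
  imports "HOL-Analysis.Analysis"
begin

definition schauder_basis :: "(nat \<Rightarrow> 'a::banach) \<Rightarrow> bool" where
  "schauder_basis e \<longleftrightarrow> (\<forall>x. \<exists>!a :: nat \<Rightarrow> real. (\<lambda>n. a n *\<^sub>R e n) sums x)"

definition biorthogonal :: "(nat \<Rightarrow> 'a::banach) \<Rightarrow> (nat \<Rightarrow> 'a \<Rightarrow>\<^sub>L real) \<Rightarrow> bool" where
  "biorthogonal e es \<longleftrightarrow> (\<forall>m n. blinfun_apply (es m) (e n) = (if m = n then 1 else 0))"

text \<open>The sequence is indexed from 0 instead of 1. The family \<open>es\<close> of functionals is
  determined by \<open>e\<close>: a continuous functional biorthogonal to a Schauder basis is the
  corresponding coordinate functional.\<close>

definition basis :: "(nat \<Rightarrow> 'a::banach) \<Rightarrow> (nat \<Rightarrow> 'a \<Rightarrow>\<^sub>L real) \<Rightarrow> bool" where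
  "basis e es \<longleftrightarrow> schauder_basis e \<and> biorthogonal e es \<and>
     0 < (INF n. min (norm (e n)) (norm (es n))) \<and>
     bdd_above (range (\<lambda>n. max (norm (e n)) (norm (es n))))"

definition weight :: "(nat \<Rightarrow> real) \<Rightarrow> bool" where
  "weight w \<longleftrightarrow> (\<forall>i. 0 < w i)"

definition supp :: "(nat \<Rightarrow> 'a::banach \<Rightarrow>\<^sub>L real) \<Rightarrow> 'a \<Rightarrow> nat set" where
  "supp es x = {i. blinfun_apply (es i) x \<noteq> 0}"

definition proj :: "(nat \<Rightarrow> 'a::banach) \<Rightarrow> (nat \<Rightarrow> 'a \<Rightarrow>\<^sub>L real) \<Rightarrow> nat set \<Rightarrow> 'a \<Rightarrow> 'a" where
  "proj e es A x = (\<Sum>j\<in>A. blinfun_apply (es j) x *\<^sub>R e j)"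

definition signs :: "(nat \<Rightarrow> real) \<Rightarrow> bool" where
  "signs \<epsilon> \<longleftrightarrow> (\<forall>n. \<epsilon> n \<in> {1, -1})"

definition signed_ind :: "(nat \<Rightarrow> 'a::banach) \<Rightarrow> (nat \<Rightarrow> real) \<Rightarrow> nat set \<Rightarrow> 'a" where
  "signed_ind e \<epsilon> A = (\<Sum>n\<in>A. \<epsilon> n *\<^sub>R e n)"

text \<open>Cardinalities of greedy sets are positive, so \<open>Min\<close> is taken over a nonempty finite set;
  the supremum is over a nonempty set, bounded when \<open>basis e es\<close> holds.\<close>

definition greedy_set :: "(nat \<Rightarrow> 'a::banach \<Rightarrow>\<^sub>L real) \<Rightarrow> 'a \<Rightarrow> nat \<Rightarrow> nat set \<Rightarrow> bool" where
  "greedy_set es x m A \<longleftrightarrow> 1 \<le> m \<and> A \<subseteq> supp es x \<and> finite A \<and> card A = m \<and>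
     (SUP k\<in>-A. \<bar>blinfun_apply (es k) x\<bar>) \<le> (MIN k\<in>A. \<bar>blinfun_apply (es k) x\<bar>)"

definition sigma_tilde ::
  "(nat \<Rightarrow> 'a::banach) \<Rightarrow> (nat \<Rightarrow> 'a \<Rightarrow>\<^sub>L real) \<Rightarrow> (nat \<Rightarrow> real) \<Rightarrow> real \<Rightarrow> 'a \<Rightarrow> real" where
  "sigma_tilde e es w \<delta> x = Inf {norm (x - proj e es A x) | A. finite A \<and> sum w A \<le> \<delta>}"

definition least_const :: "(real \<Rightarrow> bool) \<Rightarrow> real \<Rightarrow> bool" where
  "least_const P C \<longleftrightarrow> P C \<and> (\<forall>D. P D \<longrightarrow> C \<le> D)"

definition almost_greedy_bound ::
  "(nat \<Rightarrow> 'a::banach) \<Rightarrow> (nat \<Rightarrow> 'a \<Rightarrow>\<^sub>L real) \<Rightarrow> (nat \<Rightarrow> real) \<Rightarrow> real \<Rightarrow> bool" where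
  "almost_greedy_bound e es w C \<longleftrightarrow> 1 \<le> C \<and>
     (\<forall>x m A. greedy_set es x m A \<longrightarrow>
        norm (x - proj e es A x) \<le> C * sigma_tilde e es w (sum w A) x)"

definition quasi_greedy_bound ::
  "(nat \<Rightarrow> 'a::banach) \<Rightarrow> (nat \<Rightarrow> 'a \<Rightarrow>\<^sub>L real) \<Rightarrow> real \<Rightarrow> bool" where
  "quasi_greedy_bound e es C \<longleftrightarrow>
     (\<forall>x m A. greedy_set es x m A \<longrightarrow> norm (x - proj e es A x) \<le> C * norm x)"

definition property_A_bound ::
  "(nat \<Rightarrow> 'a::banach) \<Rightarrow> (nat \<Rightarrow> 'a \<Rightarrow>\<^sub>L real) \<Rightarrow> (nat \<Rightarrow> real) \<Rightarrow> real \<Rightarrow> bool" where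
  "property_A_bound e es w C \<longleftrightarrow> 1 \<le> C \<and>
     (\<forall>x A B \<epsilon> \<eta> t. finite A \<longrightarrow> finite B \<longrightarrow> sum w A \<le> sum w B \<longrightarrow> A \<inter> B = {} \<longrightarrow>
        supp es x \<inter> (A \<union> B) = {} \<longrightarrow> signs \<epsilon> \<longrightarrow> signs \<eta> \<longrightarrow>
        (SUP j. \<bar>blinfun_apply (es j) x\<bar>) \<le> t \<longrightarrow>
        norm (x + t *\<^sub>R signed_ind e \<epsilon> A) \<le> C * norm (x + t *\<^sub>R signed_ind e \<eta> B))"

text \<open>In the following three predicates the constant is the optimal one.\<close>

definition almost_greedy ::
  "(nat \<Rightarrow> 'a::banach) \<Rightarrow> (nat \<Rightarrow> 'a \<Rightarrow>\<^sub>L real) \<Rightarrow> (nat \<Rightarrow> real) \<Rightarrow> real \<Rightarrow> bool" where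
  "almost_greedy e es w = least_const (almost_greedy_bound e es w)"

definition quasi_greedy ::
  "(nat \<Rightarrow> 'a::banach) \<Rightarrow> (nat \<Rightarrow> 'a \<Rightarrow>\<^sub>L real) \<Rightarrow> real \<Rightarrow> bool" where
  "quasi_greedy e es = least_const (quasi_greedy_bound e es)"

definition property_A ::
  "(nat \<Rightarrow> 'a::banach) \<Rightarrow> (nat \<Rightarrow> 'a \<Rightarrow>\<^sub>L real) \<Rightarrow> (nat \<Rightarrow> real) \<Rightarrow> real \<Rightarrow> bool" where
  "property_A e es w = least_const (property_A_bound e es w)"

end

theory Submission
  imports Defs
begin

text \<open>
  Both parts compare the element left after removing a greedy set with the element left after
  removing another set; the constants come out sharp because each comparison is made on one
  well-chosen vector, or on a convex combination of such vectors.

  For (a), the empty set is admissible in the infimum defining the error, which gives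
  quasi-greediness. For Property (A), the vector \<open>y = x + t 1\<^bsub>\<epsilon>A\<^esub> + t 1\<^bsub>\<eta>B\<^esub>\<close> has \<open>B\<close> as a greedy set
  (ties are resolved in favour of \<open>B\<close>), and \<open>A\<close> competes with it because \<open>w(A) \<le> w(B)\<close>:
  removing \<open>B\<close> leaves one side of the inequality to be shown, removing \<open>A\<close> leaves the other.

  For (b), let \<open>A\<close> be a greedy set of \<open>x\<close>, let \<open>B\<close> be a competitor, and let \<open>t\<close> be a level that
  separates the coefficients of \<open>x\<close> on \<open>A\<close> from the others. Put \<open>z = x - P\<^bsub>A\<union>B\<^esub> x\<close>. On \<open>B - A\<close> the
  coefficients are at most \<open>t\<close>, so \<open>x - P\<^bsub>A\<^esub> x\<close> lies in the convex hull of the vectors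
  \<open>z + t 1\<^bsub>\<epsilon>(B-A)\<^esub>\<close> (lemma \<open>norm_le_of_all_signs\<close>). Property (A) moves these to \<open>z + t 1\<^bsub>\<eta>(A-B)\<^esub>\<close>
  with \<open>\<eta>\<close> the signs of \<open>x\<close>. That vector is \<open>x - P\<^bsub>B\<^esub> x\<close> with its large coefficients cut down to
  modulus \<open>t\<close>, and for a quasi-greedy basis such a truncation costs only the factor \<open>C\<^bsub>q\<^esub>\<close>
  (lemma \<open>truncation_bound\<close>).

  Two points concern the constants themselves. Every bound is a closed condition on the constant, so
  an optimal constant exists as soon as some constant works. And \<open>C\<^bsub>q\<^esub> \<ge> 1\<close>, although the definition
  does not ask for it: otherwise the norms of \<open>e\<^sub>0 + \<dots> + e\<^sub>n\<close> would grow geometrically, whereas the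
  triangle inequality lets them grow at most linearly.
\<close>

section \<open>Coordinates and greedy sets\<close>

lemma coord_sum:
  assumes "biorthogonal e es" "finite A"
  shows "blinfun_apply (es k) (\<Sum>j\<in>A. c j *\<^sub>R e j) = (if k \<in> A then c k else 0)"
proof -
  have "blinfun_apply (es k) (\<Sum>j\<in>A. c j *\<^sub>R e j) = (\<Sum>j\<in>A. c j * blinfun_apply (es k) (e j))"
    by (simp add: blinfun.sum_right blinfun.scaleR_right)
  also have "\<dots> = (\<Sum>j\<in>A. if k = j then c j else 0)"
    using assms(1) by (intro sum.cong) (auto simp: biorthogonal_def)
  finally show ?thesis using assms(2) by simp
qed

lemma coord_proj:
  assumes "biorthogonal e es" "finite A"
  shows "blinfun_apply (es k) (proj e es A x) = (if k \<in> A then blinfun_apply (es k) x else 0)"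
  unfolding proj_def by (rule coord_sum[OF assms])

lemma coord_signed_ind:
  assumes "biorthogonal e es" "finite A"
  shows "blinfun_apply (es k) (signed_ind e \<epsilon> A) = (if k \<in> A then \<epsilon> k else 0)"
  unfolding signed_ind_def by (rule coord_sum[OF assms])

lemma basis_imp_norm_bound:
  assumes "basis e es"
  obtains M where "\<And>n. norm (e n) \<le> M" "\<And>n. norm (es n) \<le> M"
proof -
  from assms obtain M where "\<forall>n. max (norm (e n)) (norm (es n)) \<le> M"
    by (auto simp: basis_def bdd_above_def)
  then show ?thesis by (intro that[of M]) auto
qed

lemma basis_imp_coords_bdd:
  fixes e :: "nat \<Rightarrow> 'a::banach"
  assumes "basis e es"
  shows "bdd_above ((\<lambda>k. \<bar>blinfun_apply (es k) x\<bar>) ` S)"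
proof -
  obtain M where "\<And>n. norm (es n) \<le> M" using basis_imp_norm_bound[OF assms] by metis
  then have "\<bar>blinfun_apply (es k) x\<bar> \<le> M * norm x" for k
    using norm_blinfun[of "es k" x] mult_right_mono[of "norm (es k)" M "norm x"] by fastforce
  then show ?thesis by (intro bdd_aboveI[of _ "M * norm x"]) auto
qed

lemma greedy_setI_level:
  assumes "finite F" "F \<noteq> {}" "F \<subseteq> supp es x"
    and "\<And>k. k \<in> F \<Longrightarrow> t \<le> \<bar>blinfun_apply (es k) x\<bar>"
    and "\<And>k. k \<notin> F \<Longrightarrow> \<bar>blinfun_apply (es k) x\<bar> \<le> t"
  shows "greedy_set es x (card F) F"
proof -
  have "-F \<noteq> {}" using \<open>finite F\<close> by (metis finite_compl finite.emptyI infinite_UNIV_nat)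
  then have "(SUP k\<in>-F. \<bar>blinfun_apply (es k) x\<bar>) \<le> t"
    using assms(5) by (intro cSUP_least) auto
  also have "t \<le> (MIN k\<in>F. \<bar>blinfun_apply (es k) x\<bar>)"
    using assms by (subst Min_ge_iff) auto
  finally show ?thesis
    using assms by (simp add: greedy_set_def Suc_le_eq card_gt_0_iff)
qed

lemma greedy_set_obtain_level:
  fixes e :: "nat \<Rightarrow> 'a::banach"
  assumes "basis e es" "greedy_set es x m A"
  obtains t where "\<And>k. k \<in> A \<Longrightarrow> t \<le> \<bar>blinfun_apply (es k) x\<bar>"
    and "\<And>k. k \<notin> A \<Longrightarrow> \<bar>blinfun_apply (es k) x\<bar> \<le> t" and "0 < t"
proof
  let ?t = "MIN k\<in>A. \<bar>blinfun_apply (es k) x\<bar>"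
  have A: "finite A" "A \<noteq> {}" "A \<subseteq> supp es x" using assms(2) by (auto simp: greedy_set_def)
  show "?t \<le> \<bar>blinfun_apply (es k) x\<bar>" if "k \<in> A" for k using A that by auto
  show "\<bar>blinfun_apply (es k) x\<bar> \<le> ?t" if "k \<notin> A" for k
  proof -
    have "\<bar>blinfun_apply (es k) x\<bar> \<le> (SUP k\<in>-A. \<bar>blinfun_apply (es k) x\<bar>)"
      using that by (intro cSUP_upper basis_imp_coords_bdd[OF assms(1)]) auto
    also have "\<dots> \<le> ?t" using assms(2) by (simp add: greedy_set_def)
    finally show ?thesis .
  qed
  show "0 < ?t" using A by (subst Min_gr_iff) (auto simp: supp_def)
qed

lemma sigma_tilde_le:
  assumes "finite A" "sum w A \<le> \<delta>"
  shows "sigma_tilde e es w \<delta> x \<le> norm (x - proj e es A x)"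
  unfolding sigma_tilde_def using assms by (intro cInf_lower bdd_belowI[of _ 0]) auto

section \<open>Optimal constants\<close>

lemma least_const_if_closed:
  assumes "closed {C. P C}" "\<And>C. P C \<Longrightarrow> l \<le> C" "P C0"
  obtains C where "least_const P C" "C \<le> C0"
proof
  let ?S = "{C. P C}"
  have bdd: "bdd_below ?S" using assms(2) by (intro bdd_belowI[of _ l]) simp
  have "Inf ?S \<in> ?S" using assms bdd by (intro closed_contains_Inf) auto
  then show "least_const P (Inf ?S)"
    using bdd by (auto simp: least_const_def intro: cInf_lower)
  show "Inf ?S \<le> C0" using assms(3) bdd by (auto intro: cInf_lower)
qed

lemma closed_almost_greedy_bound: "closed {C. almost_greedy_bound e es w C}"
  unfolding almost_greedy_bound_def
  by (intro closed_Collect_conj closed_Collect_all closed_Collect_imp open_Collect_const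
      closed_Collect_le continuous_intros)

lemma closed_quasi_greedy_bound: "closed {C. quasi_greedy_bound e es C}"
  unfolding quasi_greedy_bound_def
  by (intro closed_Collect_all closed_Collect_imp open_Collect_const
      closed_Collect_le continuous_intros)

lemma closed_property_A_bound: "closed {C. property_A_bound e es w C}"
  unfolding property_A_bound_def
  by (intro closed_Collect_conj closed_Collect_all closed_Collect_imp open_Collect_const
      closed_Collect_le continuous_intros)

text \<open>
  The nonzero coefficients of \<open>e\<^sub>0 + \<dots> + e\<^sub>n\<close> are equal, so \<open>{n}\<close> is a greedy set and removing it
  multiplies the norm by at most \<open>C\<close>. For \<open>C < 1\<close>, iteration down to \<open>e\<^sub>0\<close> contradicts the linear
  upper bound on these norms.
\<close>

lemma quasi_greedy_bound_ge_1:
  fixes e :: "nat \<Rightarrow> 'a::banach"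
  assumes "basis e es" "quasi_greedy_bound e es C"
  shows "1 \<le> C"
proof (rule ccontr)
  assume "\<not> 1 \<le> C"
  have bio: "biorthogonal e es" using assms(1) by (simp add: basis_def)
  obtain M where M: "\<And>n. norm (e n) \<le> M" using basis_imp_norm_bound[OF assms(1)] by metis
  define s where "s n = (\<Sum>k<n. e k)" for n
  have coord: "blinfun_apply (es k) (s n) = (if k < n then 1 else 0)" for k n
    using coord_sum[OF bio, of "{..<n}" k "\<lambda>_. 1"] by (simp add: s_def)
  have step: "norm (s n) \<le> C * norm (s (Suc n))" for n
  proof -
    have "greedy_set es (s (Suc n)) (card {n}) {n}"
      by (rule greedy_setI_level[of _ _ _ 1]) (auto simp: supp_def coord)
    moreover have "s (Suc n) - proj e es {n} (s (Suc n)) = s n"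
      by (simp add: proj_def coord) (simp add: s_def)
    ultimately show ?thesis using assms(2) by (metis quasi_greedy_bound_def)
  qed
  have "e 0 \<noteq> 0" using bio by (metis biorthogonal_def blinfun.zero_right zero_neq_one)
  then have pos: "0 < norm (s 1)" by (simp add: s_def)
  have "0 \<le> C"
    using step[of 1] pos norm_ge_zero[of "s (Suc 1)"] by (smt (verit) mult_nonpos_nonneg)
  have "norm (s 1) \<le> C ^ n * norm (s (Suc n))" for n
  proof (induction n)
    case (Suc n)
    have "C ^ n * norm (s (Suc n)) \<le> C ^ n * (C * norm (s (Suc (Suc n))))"
      using step \<open>0 \<le> C\<close> by (intro mult_left_mono) auto
    with Suc show ?case by (simp add: mult_ac)
  qed simp
  moreover have "norm (s n) \<le> real n * M" for n
    using sum_norm_le[of "{..<n}" e "\<lambda>_. M"] M by (simp add: s_def)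
  ultimately have "norm (s 1) \<le> C ^ n * (real (Suc n) * M)" for n
    using \<open>0 \<le> C\<close> by (meson mult_left_mono order_trans zero_le_power)
  then have "norm (s 1) \<le> (real n * C ^ n + C ^ n) * M" for n
    by (simp add: algebra_simps)
  moreover have "(\<lambda>n. (real n * C ^ n + C ^ n) * M) \<longlonglongrightarrow> (0 + 0) * M"
    using \<open>0 \<le> C\<close> \<open>\<not> 1 \<le> C\<close>
    by (intro tendsto_intros powser_times_n_limit_0 LIMSEQ_power_zero) auto
  ultimately have "norm (s 1) \<le> (0 + 0) * M"
    by (intro LIMSEQ_le_const) auto
  with pos show False by simp
qed

section \<open>From almost greedy to quasi-greedy and Property (A)\<close>

lemma almost_greedy_imp_quasi_greedy_bound:
  assumes "weight w" "almost_greedy_bound e es w C"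
  shows "quasi_greedy_bound e es C"
  unfolding quasi_greedy_bound_def
proof (intro allI impI)
  fix x m A assume A: "greedy_set es x m A"
  have "0 \<le> sum w A" using assms(1) by (intro sum_nonneg) (simp add: weight_def less_imp_le)
  then have "sigma_tilde e es w (sum w A) x \<le> norm x"
    using sigma_tilde_le[of "{}" w "sum w A" e es x] by (simp add: proj_def)
  moreover have "0 \<le> C" "norm (x - proj e es A x) \<le> C * sigma_tilde e es w (sum w A) x"
    using assms(2) A by (auto simp: almost_greedy_bound_def)
  ultimately show "norm (x - proj e es A x) \<le> C * norm x"
    by (meson mult_left_mono order_trans)
qed

lemma almost_greedy_imp_property_A_bound:
  fixes e :: "nat \<Rightarrow> 'a::banach"
  assumes basis: "basis e es" and w: "weight w" and ag: "almost_greedy_bound e es w C"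
  shows "property_A_bound e es w C"
  unfolding property_A_bound_def
proof (intro conjI allI impI)
  show C: "1 \<le> C" using ag by (simp add: almost_greedy_bound_def)
  have bio: "biorthogonal e es" using basis by (simp add: basis_def)
  fix x A B \<epsilon> \<eta> t
  assume fin: "finite A" "finite B" and wAB: "sum w A \<le> sum w B" and disj: "A \<inter> B = {}"
    and supp: "supp es x \<inter> (A \<union> B) = {}" and sg: "signs \<epsilon>" "signs \<eta>"
    and "(SUP j. \<bar>blinfun_apply (es j) x\<bar>) \<le> t"
  then have t: "\<bar>blinfun_apply (es j) x\<bar> \<le> t" for j
    using cSUP_upper[OF UNIV_I basis_imp_coords_bdd[OF basis, of x], of j] by linarith
  show "norm (x + t *\<^sub>R signed_ind e \<epsilon> A) \<le> C * norm (x + t *\<^sub>R signed_ind e \<eta> B)"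
  proof (cases "t = 0 \<or> B = {}")
    case True
    moreover have "A = {}" if "B = {}"
      using that wAB sum_pos[of A w] fin w by (force simp: weight_def)
    ultimately have zero: "t *\<^sub>R signed_ind e \<epsilon> A = 0" "t *\<^sub>R signed_ind e \<eta> B = 0"
      by (auto simp: signed_ind_def)
    show ?thesis unfolding zero using mult_right_mono[OF C, of "norm x"] by simp
  next
    case False
    with t[of 0] have "0 < t" by linarith
    have x0: "blinfun_apply (es k) x = 0" if "k \<in> A \<union> B" for k
      using supp that by (auto simp: supp_def)
    have sg1: "\<bar>\<epsilon> k\<bar> = 1" "\<bar>\<eta> k\<bar> = 1" for k
      using sg[unfolded signs_def, rule_format, of k] by auto
    define y where "y = x + t *\<^sub>R signed_ind e \<epsilon> A + t *\<^sub>R signed_ind e \<eta> B"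
    have y: "blinfun_apply (es k) y = (if k \<in> A then t * \<epsilon> k else if k \<in> B then t * \<eta> k
        else blinfun_apply (es k) x)" for k
      using disj x0 by (auto simp: y_def blinfun.add_right blinfun.scaleR_right
          coord_signed_ind[OF bio] fin)
    have "greedy_set es y (card B) B"
    proof (rule greedy_setI_level[of _ _ _ t])
      show "B \<subseteq> supp es y"
      proof
        fix k assume "k \<in> B"
        then have "\<bar>blinfun_apply (es k) y\<bar> = t" using disj \<open>0 < t\<close> by (auto simp: y abs_mult sg1)
        with \<open>0 < t\<close> show "k \<in> supp es y" by (auto simp: supp_def)
      qed
      show "t \<le> \<bar>blinfun_apply (es k) y\<bar>" if "k \<in> B" for k
        using that disj \<open>0 < t\<close> by (auto simp: y abs_mult sg1)
      show "\<bar>blinfun_apply (es k) y\<bar> \<le> t" if "k \<notin> B" for k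
        using that \<open>0 < t\<close> t by (auto simp: y abs_mult sg1)
    qed (use fin False in auto)
    then have "norm (y - proj e es B y) \<le> C * sigma_tilde e es w (sum w B) y"
      using ag by (simp add: almost_greedy_bound_def)
    also have "\<dots> \<le> C * norm (y - proj e es A y)"
      using C by (intro mult_left_mono sigma_tilde_le fin wAB) auto
    also have "proj e es A y = t *\<^sub>R signed_ind e \<epsilon> A"
      by (simp add: proj_def signed_ind_def scaleR_sum_right y)
    also have "proj e es B y = t *\<^sub>R signed_ind e \<eta> B"
      using disj by (auto simp: proj_def signed_ind_def scaleR_sum_right y intro!: sum.cong)
    finally show ?thesis by (simp add: y_def)
  qed
qed

section \<open>From quasi-greedy and Property (A) to almost greedy\<close>

lemma norm_le_of_endpoints:
  fixes u v :: "'a::real_normed_vector"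
  assumes "norm (u + t *\<^sub>R v) \<le> M" "norm (u - t *\<^sub>R v) \<le> M" "\<bar>c\<bar> \<le> t"
  shows "norm (u + c *\<^sub>R v) \<le> M"
proof (cases "t = 0")
  case False
  with assms(3) have "0 < t" by linarith
  define a where "a = (1 + c / t) / 2"
  have a: "0 \<le> a" "0 \<le> 1 - a" using assms(3) \<open>0 < t\<close> by (auto simp: a_def field_simps)
  have "a * t + a * t = c + t" using \<open>0 < t\<close> by (simp add: a_def field_simps)
  then have "(a * t) *\<^sub>R v + (a * t) *\<^sub>R v = c *\<^sub>R v + t *\<^sub>R v"
    by (metis scaleR_add_left)
  then have "u + c *\<^sub>R v = a *\<^sub>R (u + t *\<^sub>R v) + (1 - a) *\<^sub>R (u - t *\<^sub>R v)"
    by (simp add: algebra_simps)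
  then show ?thesis
    using convexD_alt[OF convex_cball[of "0 :: 'a" M], of "u - t *\<^sub>R v" "u + t *\<^sub>R v" a] a assms
    by (simp add: add.commute)
qed (use assms in auto)

text \<open>
  A cube is the convex hull of its vertices, and a norm bound passes to convex hulls.
\<close>

lemma norm_le_of_all_signs:
  fixes e :: "nat \<Rightarrow> 'a::banach"
  assumes "finite B" "\<And>k. k \<in> B \<Longrightarrow> \<bar>c k\<bar> \<le> t"
    and "\<And>\<epsilon>. signs \<epsilon> \<Longrightarrow> norm (z + t *\<^sub>R signed_ind e \<epsilon> B) \<le> M"
  shows "norm (z + (\<Sum>k\<in>B. c k *\<^sub>R e k)) \<le> M"
  using assms
proof (induction B arbitrary: z rule: finite_induct)
  case empty
  have "signs (\<lambda>_. 1)" by (simp add: signs_def)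
  with empty.prems(2) show ?case by (force simp: signed_ind_def)
next
  case (insert b B)
  have "norm ((z + c b *\<^sub>R e b) + (\<Sum>k\<in>B. c k *\<^sub>R e k)) \<le> M"
  proof (rule insert.IH)
    fix \<epsilon> :: "nat \<Rightarrow> real" assume "signs \<epsilon>"
    then have sg: "signs (\<epsilon>(b := 1))" "signs (\<epsilon>(b := -1))" by (auto simp: signs_def)
    have upd: "signed_ind e (\<epsilon>(b := s)) (insert b B) = s *\<^sub>R e b + signed_ind e \<epsilon> B" for s
      using insert.hyps by (auto simp: signed_ind_def intro!: sum.cong)
    have "norm ((z + t *\<^sub>R signed_ind e \<epsilon> B) + c b *\<^sub>R e b) \<le> M"
    proof (rule norm_le_of_endpoints)
      show "norm ((z + t *\<^sub>R signed_ind e \<epsilon> B) + t *\<^sub>R e b) \<le> M"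
        using insert.prems(2)[OF sg(1)] unfolding upd by (simp add: algebra_simps)
      show "norm ((z + t *\<^sub>R signed_ind e \<epsilon> B) - t *\<^sub>R e b) \<le> M"
        using insert.prems(2)[OF sg(2)] unfolding upd by (simp add: algebra_simps)
    qed (use insert.prems(1) in simp)
    then show "norm (z + c b *\<^sub>R e b + t *\<^sub>R signed_ind e \<epsilon> B) \<le> M"
      by (simp add: algebra_simps)
  qed (use insert.prems(1) in auto)
  then show ?case using insert.hyps by (simp add: add.assoc)
qed

text \<open>
  Truncation to modulus \<open>t\<close> is an average of the vectors obtained by removing the coefficients above
  a level, as the level varies. With finitely many large coefficients this average can be built one
  step at a time: let \<open>r\<close> be the smallest of the large moduli. Truncating at \<open>r\<close> changes fewer
  coefficients, and truncating at \<open>t\<close> is the convex combination, with weights \<open>t / r\<close> and \<open>1 - t / r\<close>, of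
  truncating at \<open>r\<close> and removing the large coefficients altogether.
\<close>

lemma truncation_bound:
  fixes e :: "nat \<Rightarrow> 'a::banach"
  assumes qg: "quasi_greedy_bound e es C" and "1 \<le> C"
    and "finite F" "0 < t"
    and "\<And>k. k \<in> F \<Longrightarrow> t \<le> \<bar>blinfun_apply (es k) y\<bar>"
    and "\<And>k. k \<notin> F \<Longrightarrow> \<bar>blinfun_apply (es k) y\<bar> \<le> t"
  shows "norm (y - proj e es F y + t *\<^sub>R signed_ind e (\<lambda>k. sgn (blinfun_apply (es k) y)) F) \<le> C * norm y"
  using assms(3-)
proof (induction "card F" arbitrary: F t)
  case 0
  then have "F = {}" by simp
  then show ?case using mult_right_mono[OF \<open>1 \<le> C\<close>, of "norm y"]
    by (simp add: proj_def signed_ind_def)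
next
  case (Suc n)
  let ?sg = "\<lambda>k. sgn (blinfun_apply (es k) y)"
  have "F \<noteq> {}" using Suc.hyps(2) by auto
  then obtain b where b: "b \<in> F"
    and b_min: "\<And>k. k \<in> F \<Longrightarrow> \<bar>blinfun_apply (es b) y\<bar> \<le> \<bar>blinfun_apply (es k) y\<bar>"
    using ex_min_if_finite[of "(\<lambda>k. \<bar>blinfun_apply (es k) y\<bar>) ` F"] \<open>finite F\<close>
    by (force simp: not_less)
  define r where "r = \<bar>blinfun_apply (es b) y\<bar>"
  have r: "t \<le> r" "0 < r" using Suc.prems b by (force simp: r_def)+
  have IH: "norm (y - proj e es (F - {b}) y + r *\<^sub>R signed_ind e ?sg (F - {b})) \<le> C * norm y"
  proof (rule Suc.hyps(1))
    show "\<bar>blinfun_apply (es k) y\<bar> \<le> r" if "k \<notin> F - {b}" for k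
      using that Suc.prems(4)[of k] r by (cases "k = b") (auto simp: r_def)
  qed (use Suc b b_min r in \<open>auto simp: r_def\<close>)
  have "blinfun_apply (es b) y = r * ?sg b" by (simp add: r_def abs_mult_sgn)
  \<comment> \<open>Truncating at \<open>r\<close> leaves the coefficient at \<open>b\<close> alone.\<close>
  then have "y - proj e es (F - {b}) y + r *\<^sub>R signed_ind e ?sg (F - {b})
      = y - proj e es F y + r *\<^sub>R signed_ind e ?sg F"
    using Suc.prems(1) b
    by (simp add: proj_def signed_ind_def sum.remove[of F b] algebra_simps)
  with IH have trunc_r: "norm (y - proj e es F y + r *\<^sub>R signed_ind e ?sg F) \<le> C * norm y"
    by simp
  have "greedy_set es y (card F) F"
    using Suc.prems \<open>F \<noteq> {}\<close> by (intro greedy_setI_level[of _ _ _ t]) (force simp: supp_def)+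
  then have rem: "norm (y - proj e es F y) \<le> C * norm y"
    using qg by (simp add: quasi_greedy_bound_def)
  have "y - proj e es F y + t *\<^sub>R signed_ind e ?sg F
      = (1 - t / r) *\<^sub>R (y - proj e es F y)
        + (t / r) *\<^sub>R (y - proj e es F y + r *\<^sub>R signed_ind e ?sg F)"
    using r(2) by (simp add: scaleR_diff_left scaleR_add_right)
  then show ?case
    using convexD_alt[OF convex_cball[of "0 :: 'a" "C * norm y"] , of "y - proj e es F y"
        "y - proj e es F y + r *\<^sub>R signed_ind e ?sg F" "t / r"] trunc_r rem r Suc.prems(2)
    by simp
qed

lemma quasi_greedy_property_A_imp_almost_greedy_bound:
  fixes e :: "nat \<Rightarrow> 'a::banach"
  assumes basis: "basis e es"
    and qg: "quasi_greedy_bound e es C\<^sub>q" and pA: "property_A_bound e es w C\<^sub>a"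
  shows "almost_greedy_bound e es w (C\<^sub>q * C\<^sub>a)"
  unfolding almost_greedy_bound_def
proof (intro conjI allI impI)
  have bio: "biorthogonal e es" using basis by (simp add: basis_def)
  have Cq: "1 \<le> C\<^sub>q" by (rule quasi_greedy_bound_ge_1[OF basis qg])
  have Ca: "1 \<le> C\<^sub>a" using pA by (simp add: property_A_bound_def)
  show "1 \<le> C\<^sub>q * C\<^sub>a" using mult_mono[OF Cq Ca] Cq by simp
  fix x m A assume A: "greedy_set es x m A"
  then have finA: "finite A" by (simp add: greedy_set_def)
  obtain t where t_le: "\<And>k. k \<in> A \<Longrightarrow> t \<le> \<bar>blinfun_apply (es k) x\<bar>"
    and le_t: "\<And>k. k \<notin> A \<Longrightarrow> \<bar>blinfun_apply (es k) x\<bar> \<le> t" and "0 < t"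
    using greedy_set_obtain_level[OF basis A] by metis
  have competitor: "norm (x - proj e es A x) \<le> C\<^sub>q * C\<^sub>a * norm (x - proj e es B x)"
    if finB: "finite B" and wBA: "sum w B \<le> sum w A" for B
  proof -
    define z where "z = x - proj e es (A \<union> B) x"
    define y where "y = x - proj e es B x"
    have z: "blinfun_apply (es k) z = (if k \<in> A \<union> B then 0 else blinfun_apply (es k) x)" for k
      by (simp add: z_def blinfun.diff_right coord_proj[OF bio] finA finB)
    have y: "blinfun_apply (es k) y = (if k \<in> B then 0 else blinfun_apply (es k) x)" for k
      by (simp add: y_def blinfun.diff_right coord_proj[OF bio] finB)
    have "sum w B = sum w (B - A) + sum w (B \<inter> A)" "sum w A = sum w (A - B) + sum w (B \<inter> A)"
      using sum.Int_Diff[OF finB, of w A] sum.Int_Diff[OF finA, of w B] by (simp_all add: Int_commute)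
    with wBA have w_diff: "sum w (B - A) \<le> sum w (A - B)" by linarith
    have sup_z: "(SUP j. \<bar>blinfun_apply (es j) z\<bar>) \<le> t"
      using le_t \<open>0 < t\<close> by (intro cSUP_least) (auto simp: z)
    have supp_z: "supp es z \<inter> ((B - A) \<union> (A - B)) = {}" by (auto simp: supp_def z)
    \<comment> \<open>The value 1 at zero coefficients makes \<open>\<eta>\<close> a sign sequence on all indices, which \<open>sgn\<close> is not.\<close>
    define \<eta> where "\<eta> k = (if 0 \<le> blinfun_apply (es k) y then 1 else -1 :: real)" for k
    have "signs \<eta>" by (simp add: signs_def \<eta>_def)
    have "norm (z + (\<Sum>k\<in>B - A. blinfun_apply (es k) x *\<^sub>R e k))
        \<le> C\<^sub>a * norm (z + t *\<^sub>R signed_ind e \<eta> (A - B))"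
    proof (rule norm_le_of_all_signs[where t = t])
      show "norm (z + t *\<^sub>R signed_ind e \<epsilon> (B - A)) \<le> C\<^sub>a * norm (z + t *\<^sub>R signed_ind e \<eta> (A - B))"
        if "signs \<epsilon>" for \<epsilon>
        by (rule pA[unfolded property_A_bound_def, THEN conjunct2, rule_format])
          (use finA finB w_diff supp_z that \<open>signs \<eta>\<close> sup_z in auto)
    qed (use finB le_t in auto)
    moreover have "z + (\<Sum>k\<in>B - A. blinfun_apply (es k) x *\<^sub>R e k) = x - proj e es A x"
      using sum.union_disjoint[of A "B - A" "\<lambda>k. blinfun_apply (es k) x *\<^sub>R e k"] finA finB
      by (simp add: z_def proj_def)
    moreover have "norm (z + t *\<^sub>R signed_ind e \<eta> (A - B)) \<le> C\<^sub>q * norm y"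
    proof -
      have "proj e es (A - B) y = (\<Sum>k\<in>A - B. blinfun_apply (es k) x *\<^sub>R e k)"
        by (auto simp: proj_def y intro!: sum.cong)
      then have "y - proj e es (A - B) y = z"
        using sum.union_disjoint[of B "A - B" "\<lambda>k. blinfun_apply (es k) x *\<^sub>R e k"] finA finB
        by (simp add: z_def y_def proj_def Un_commute)
      moreover have "signed_ind e \<eta> (A - B) = signed_ind e (\<lambda>k. sgn (blinfun_apply (es k) y)) (A - B)"
        unfolding signed_ind_def
      proof (rule sum.cong)
        fix k assume "k \<in> A - B"
        then have "blinfun_apply (es k) y \<noteq> 0" using t_le[of k] \<open>0 < t\<close> by (auto simp: y)
        then show "\<eta> k *\<^sub>R e k = sgn (blinfun_apply (es k) y) *\<^sub>R e k" by (simp add: \<eta>_def sgn_if)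
      qed simp
      moreover have "norm (y - proj e es (A - B) y
          + t *\<^sub>R signed_ind e (\<lambda>k. sgn (blinfun_apply (es k) y)) (A - B)) \<le> C\<^sub>q * norm y"
        by (rule truncation_bound[OF qg Cq]) (use finA \<open>0 < t\<close> t_le le_t in \<open>auto simp: y\<close>)
      ultimately show ?thesis by simp
    qed
    ultimately have "norm (x - proj e es A x) \<le> C\<^sub>a * norm (z + t *\<^sub>R signed_ind e \<eta> (A - B))"
      and "C\<^sub>a * norm (z + t *\<^sub>R signed_ind e \<eta> (A - B)) \<le> C\<^sub>a * (C\<^sub>q * norm y)"
      using Ca by (simp_all add: mult_left_mono)
    then show ?thesis by (simp add: y_def mult_ac)
  qed
  have pos: "0 < C\<^sub>q * C\<^sub>a" using Cq Ca by simp
  have "norm (x - proj e es A x) / (C\<^sub>q * C\<^sub>a) \<le> sigma_tilde e es w (sum w A) x"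
    unfolding sigma_tilde_def
  proof (intro cInf_greatest)
    show "{norm (x - proj e es B x) |B. finite B \<and> sum w B \<le> sum w A} \<noteq> {}"
      using finA by blast
    fix v assume "v \<in> {norm (x - proj e es B x) |B. finite B \<and> sum w B \<le> sum w A}"
    then have "norm (x - proj e es A x) \<le> C\<^sub>q * C\<^sub>a * v" using competitor by blast
    then show "norm (x - proj e es A x) / (C\<^sub>q * C\<^sub>a) \<le> v"
      using pos by (simp only: pos_divide_le_eq mult.commute[of v])
  qed
  then show "norm (x - proj e es A x) \<le> C\<^sub>q * C\<^sub>a * sigma_tilde e es w (sum w A) x"
    using pos by (simp only: pos_divide_le_eq mult.commute[of "sigma_tilde e es w (sum w A) x"])
qed

section \<open>The characterization with optimal constants\<close>

theorem theorem2p2: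
  fixes e :: "nat \<Rightarrow> 'a::banach" and es :: "nat \<Rightarrow> 'a \<Rightarrow>\<^sub>L real" and w :: "nat \<Rightarrow> real"
  assumes "basis e es" and "weight w"
  shows "(\<forall>C\<^sub>a\<^sub>l. almost_greedy e es w C\<^sub>a\<^sub>l \<longrightarrow>
            (\<exists>C\<^sub>q C\<^sub>a. quasi_greedy e es C\<^sub>q \<and> property_A e es w C\<^sub>a \<and> C\<^sub>q \<le> C\<^sub>a\<^sub>l \<and> C\<^sub>a \<le> C\<^sub>a\<^sub>l)) \<and>
         (\<forall>C\<^sub>q C\<^sub>a. quasi_greedy e es C\<^sub>q \<and> property_A e es w C\<^sub>a \<longrightarrow>
            (\<exists>C\<^sub>a\<^sub>l. almost_greedy e es w C\<^sub>a\<^sub>l \<and> C\<^sub>a\<^sub>l \<le> C\<^sub>q * C\<^sub>a))"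
proof (intro conjI allI impI)
  fix C\<^sub>a\<^sub>l assume "almost_greedy e es w C\<^sub>a\<^sub>l"
  then have ag: "almost_greedy_bound e es w C\<^sub>a\<^sub>l" by (simp add: almost_greedy_def least_const_def)
  obtain C\<^sub>q where "least_const (quasi_greedy_bound e es) C\<^sub>q" "C\<^sub>q \<le> C\<^sub>a\<^sub>l"
    using least_const_if_closed[OF closed_quasi_greedy_bound quasi_greedy_bound_ge_1[OF assms(1)]
        almost_greedy_imp_quasi_greedy_bound[OF assms(2) ag]] by metis
  moreover obtain C\<^sub>a where "least_const (property_A_bound e es w) C\<^sub>a" "C\<^sub>a \<le> C\<^sub>a\<^sub>l"
    using least_const_if_closed[OF closed_property_A_bound _
        almost_greedy_imp_property_A_bound[OF assms ag], of 1]
    by (metis property_A_bound_def)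
  ultimately show "\<exists>C\<^sub>q C\<^sub>a. quasi_greedy e es C\<^sub>q \<and> property_A e es w C\<^sub>a \<and> C\<^sub>q \<le> C\<^sub>a\<^sub>l \<and> C\<^sub>a \<le> C\<^sub>a\<^sub>l"
    by (auto simp: quasi_greedy_def property_A_def)
next
  fix C\<^sub>q C\<^sub>a assume "quasi_greedy e es C\<^sub>q \<and> property_A e es w C\<^sub>a"
  then have "quasi_greedy_bound e es C\<^sub>q" "property_A_bound e es w C\<^sub>a"
    by (auto simp: quasi_greedy_def property_A_def least_const_def)
  then have "almost_greedy_bound e es w (C\<^sub>q * C\<^sub>a)"
    by (rule quasi_greedy_property_A_imp_almost_greedy_bound[OF assms(1)])
  then obtain C\<^sub>a\<^sub>l where "least_const (almost_greedy_bound e es w) C\<^sub>a\<^sub>l" "C\<^sub>a\<^sub>l \<le> C\<^sub>q * C\<^sub>a"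
    using least_const_if_closed[OF closed_almost_greedy_bound, of e es w 1]
    by (metis almost_greedy_bound_def)
  then show "\<exists>C\<^sub>a\<^sub>l. almost_greedy e es w C\<^sub>a\<^sub>l \<and> C\<^sub>a\<^sub>l \<le> C\<^sub>q * C\<^sub>a"
    by (auto simp: almost_greedy_def)
qed

end
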